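(* Let $G$ and $H$ be graphs, with $\mathcal V(G)=\{v_1,\dots,v_k\}$. Then: (i) $\alpha^*(G|H)=\max_{\mathbf w}\sum_{i=1}^k w_i$, where the maximum is over $\mathbf w=(w_1,\dots,w_k)$ with $w_i\ge 0$ and $\sum_{i=1}^k w_i|f(v_i)|\le 1$ for every $f\in\mathcal F(H,G)$ (equivalently, $\sum_i w_i|\mathcal T_i|\le 1$ for every collection $\mathcal T_1,\dots,\mathcal T_k\in\mathcal I(H)$ such that $\mathcal T_i,\mathcal T_j$ are disconnected in $H$ whenever $i\neq j$ and $v_iv_j\notin\mathcal E(G)$). (ii) $\dfrac{1}{\alpha^*(G|H)}=\min_{w_i\ge 0,\ \sum_i w_i=1}\ \max_{f\in\mathcal F(H,G)}\sum_{i=1}^k w_i|f(v_i)|$. (iii) $\alpha^*(G|H)=\min_p \max_{v\in\mathcal V(G)}\dfrac{1}{\mathbb E[|F(v)|]}$, where the minimum is over all probability distributions $p$ on $\mathcal F(H,G)$ and $F\sim p$ is a random element of $\mathcal F(H,G)$. (iv) There exists a graph $W$ with $\alpha^*(G|H)=\dfrac{\alpha(G\boxtimes W)}{\alpha(H\boxtimes W)}$; i.e. the supremum defining $\alpha^*(G|H)$ is attained.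
   Context: All graphs are finite, simple, undirected. $\alpha$ is the independence number; $G\boxtimes H$ is the strong product (vertex set $\mathcal V(G)\times\mathcal V(H)$; distinct $(u,u'),(v,v')$ adjacent iff ($u=v$ or $uv\in\mathcal E(G)$) and ($u'=v'$ or $u'v'\in\mathcal E(H)$)). The relative fractional independence number is $\alpha^*(G|H)=\sup_W \frac{\alpha(G\boxtimes W)}{\alpha(H\boxtimes W)}$, the supremum over all graphs $W$. $\mathcal I(H)$ is the set of independent sets of $H$ (including $\emptyset$); $\mathcal S,\mathcal T\in\mathcal I(H)$ are disconnected in $H$ if $\mathcal S\cap\mathcal T=\emptyset$ and $\mathcal S\cup\mathcal T\in\mathcal I(H)$. $\mathcal F(H,G)$ is the set of functions $f:\mathcal V(G)\to\mathcal I(H)$ such that $f(v_1),f(v_2)$ are disconnected in $H$ whenever $v_1\ne v_2$ are non-adjacent in $G$. Convention $1/0=\infty$. *)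

theory Defs
  imports
    "HOL-Probability.Probability_Mass_Function"
    "Graph_Theory.Pair_Digraph"
begin

text \<open>
  \<^locale>\<open>pair_graph\<close> is the locale of finite, loopfree, symmetric digraphs whose arcs are ordered
  pairs, i.e. of finite simple undirected graphs. The null graph is excluded: a quotient of
  independence numbers is undefined when the denominator vanishes.
\<close>

definition nonempty_graph :: "'a pair_pre_digraph \<Rightarrow> bool" where
  "nonempty_graph G \<longleftrightarrow> pair_graph G \<and> pverts G \<noteq> {}"

definition independent_sets :: "'a pair_pre_digraph \<Rightarrow> 'a set set" where
  "independent_sets G = {S. S \<subseteq> pverts G \<and> (\<forall>u\<in>S. \<forall>v\<in>S. (u, v) \<notin> parcs G)}"

definition independence_number :: "'a pair_pre_digraph \<Rightarrow> nat" where
  "independence_number G = Max (card ` independent_sets G)"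

definition strong_product ::
    "'a pair_pre_digraph \<Rightarrow> 'b pair_pre_digraph \<Rightarrow> ('a \<times> 'b) pair_pre_digraph"  (infixl "\<boxtimes>" 70)
  where
  "G \<boxtimes> H = \<lparr> pverts = pverts G \<times> pverts H,
     parcs = {((u, u'), (v, v')) | u u' v v'.
       (u, u') \<in> pverts G \<times> pverts H \<and> (v, v') \<in> pverts G \<times> pverts H \<and>
       (u, u') \<noteq> (v, v') \<and>
       (u = v \<or> (u, v) \<in> parcs G) \<and> (u' = v' \<or> (u', v') \<in> parcs H)} \<rparr>"

definition independence_ratio ::
    "'a pair_pre_digraph \<Rightarrow> 'b pair_pre_digraph \<Rightarrow> 'c pair_pre_digraph \<Rightarrow> real" where
  "independence_ratio G H W =
     real (independence_number (G \<boxtimes> W)) / real (independence_number (H \<boxtimes> W))"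

text \<open>
  The supremum is taken in the extended reals, where it exists unconditionally. Every finite graph
  is isomorphic to one with vertices in \<^typ>\<open>nat\<close>, so letting \<open>W\<close> range over the latter loses
  nothing; see \<open>independence_ratio_le\<close> below.
\<close>

definition relative_fractional_independence_number ::
    "'a pair_pre_digraph \<Rightarrow> 'b pair_pre_digraph \<Rightarrow> ereal" where
  "relative_fractional_independence_number G H =
     (SUP W \<in> {W :: nat pair_pre_digraph. nonempty_graph W}. ereal (independence_ratio G H W))"

definition disconnected :: "'a pair_pre_digraph \<Rightarrow> 'a set \<Rightarrow> 'a set \<Rightarrow> bool" where
  "disconnected H S T \<longleftrightarrow> S \<inter> T = {} \<and> S \<union> T \<in> independent_sets H"

definition independent_set_maps ::
    "'b pair_pre_digraph \<Rightarrow> 'a pair_pre_digraph \<Rightarrow> ('a \<Rightarrow> 'b set) set" where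
  "independent_set_maps H G =
     {f \<in> pverts G \<rightarrow>\<^sub>E independent_sets H.
       \<forall>u\<in>pverts G. \<forall>v\<in>pverts G. u \<noteq> v \<longrightarrow> (u, v) \<notin> parcs G \<longrightarrow> disconnected H (f u) (f v)}"

definition is_maximum :: "'a::linorder set \<Rightarrow> 'a \<Rightarrow> bool" where
  "is_maximum S m \<longleftrightarrow> m \<in> S \<and> (\<forall>x\<in>S. x \<le> m)"

definition is_minimum :: "'a::linorder set \<Rightarrow> 'a \<Rightarrow> bool" where
  "is_minimum S m \<longleftrightarrow> m \<in> S \<and> (\<forall>x\<in>S. m \<le> x)"


lemma finite_independent_sets: "finite (pverts G) \<Longrightarrow> finite (independent_sets G)"
  by (rule finite_subset[of _ "Pow (pverts G)"]) (auto simp: independent_sets_def)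

lemma empty_in_independent_sets: "{} \<in> independent_sets G"
  by (simp add: independent_sets_def)

lemma finite_independent_set_maps:
  assumes "finite (pverts G)" "finite (pverts H)"
  shows "finite (independent_set_maps H G)"
proof (rule finite_subset)
  show "independent_set_maps H G \<subseteq> pverts G \<rightarrow>\<^sub>E independent_sets H"
    by (auto simp: independent_set_maps_def)
  show "finite (pverts G \<rightarrow>\<^sub>E independent_sets H)"
    using assms by (intro finite_PiE finite_independent_sets)
qed

lemma independent_set_maps_nonempty: "independent_set_maps H G \<noteq> {}"
proof -
  have "(\<lambda>v\<in>pverts G. {}) \<in> independent_set_maps H G"
    by (auto simp: independent_set_maps_def disconnected_def empty_in_independent_sets)
  then show ?thesis by blast
qed

lemma independence_number_iso:
  assumes inj: "inj_on h (pverts G)" and verts: "pverts G' = h ` pverts G"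
    and arcs: "\<And>u v. u \<in> pverts G \<Longrightarrow> v \<in> pverts G \<Longrightarrow> (h u, h v) \<in> parcs G' \<longleftrightarrow> (u, v) \<in> parcs G"
  shows "independence_number G' = independence_number G"
proof -
  have indep: "h ` S \<in> independent_sets G' \<longleftrightarrow> S \<in> independent_sets G" if "S \<subseteq> pverts G" for S
    using that arcs by (auto simp: independent_sets_def verts subset_iff)
  have "independent_sets G' = (`) h ` independent_sets G"
  proof (intro equalityI subsetI)
    fix T assume T: "T \<in> independent_sets G'"
    then have "T \<subseteq> h ` pverts G" by (simp add: independent_sets_def verts)
    then obtain S where "S \<subseteq> pverts G" "T = h ` S" by (auto simp: subset_image_iff)
    with T show "T \<in> (`) h ` independent_sets G" using indep by auto
  next
    fix T assume "T \<in> (`) h ` independent_sets G"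
    then show "T \<in> independent_sets G'" using indep by (auto simp: independent_sets_def)
  qed
  then have "card ` independent_sets G' = (\<lambda>S. card (h ` S)) ` independent_sets G"
    by (simp add: image_image)
  also have "\<dots> = card ` independent_sets G"
    by (rule image_cong)
      (auto simp: independent_sets_def intro!: card_image inj_on_subset[OF inj])
  finally show ?thesis by (simp add: independence_number_def)
qed

lemma independence_number_strong_product_iso:
  assumes inj: "inj_on h (pverts W)" and verts: "pverts W' = h ` pverts W"
    and arcs: "\<And>u v. u \<in> pverts W \<Longrightarrow> v \<in> pverts W \<Longrightarrow> (h u, h v) \<in> parcs W' \<longleftrightarrow> (u, v) \<in> parcs W"
  shows "independence_number (G \<boxtimes> W') = independence_number (G \<boxtimes> W)"
proof (rule independence_number_iso[where h = "map_prod id h"])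
  show "inj_on (map_prod id h) (pverts (G \<boxtimes> W))"
    using inj by (auto simp: strong_product_def inj_on_def)
  show "pverts (G \<boxtimes> W') = map_prod id h ` pverts (G \<boxtimes> W)"
    by (auto simp: strong_product_def verts image_iff)
  show "(map_prod id h u, map_prod id h v) \<in> parcs (G \<boxtimes> W') \<longleftrightarrow> (u, v) \<in> parcs (G \<boxtimes> W)"
    if "u \<in> pverts (G \<boxtimes> W)" "v \<in> pverts (G \<boxtimes> W)" for u v
    using that arcs inj_onD[OF inj]
    by (cases u; cases v) (auto simp: strong_product_def verts)
qed

lemma independence_ratio_le:
  fixes W :: "'c pair_pre_digraph"
  assumes W: "nonempty_graph W"
  shows "ereal (independence_ratio G H W) \<le> relative_fractional_independence_number G H"
proof -
  interpret pair_graph W using W by (simp add: nonempty_graph_def)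
  obtain h :: "'c \<Rightarrow> nat" where inj: "inj_on h (pverts W)"
    using finite_imp_inj_to_nat_seg[OF pair_finite_verts] by blast
  define W' where "W' = \<lparr> pverts = h ` pverts W, parcs = map_prod h h ` parcs W \<rparr>"
  have arcs: "(h u, h v) \<in> parcs W' \<longleftrightarrow> (u, v) \<in> parcs W"
    if "u \<in> pverts W" "v \<in> pverts W" for u v
  proof
    assume "(h u, h v) \<in> parcs W'"
    then obtain a b where ab: "(a, b) \<in> parcs W" "h u = h a" "h v = h b"
      by (auto simp: W'_def)
    then have "u = a" "v = b"
      using that wellformed'[OF ab(1)] by (auto dest: inj_onD[OF inj])
    with ab show "(u, v) \<in> parcs W" by simp
  qed (auto simp: W'_def intro: rev_image_eqI)
  have "pair_graph W'"
  proof
    show "fst e \<in> pverts W'" "snd e \<in> pverts W'" if "e \<in> parcs W'" for e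
      using that by (auto simp: W'_def dest: wellformed')
    show "finite (pverts W')" "finite (parcs W')"
      using pair_finite_verts pair_finite_arcs by (simp_all add: W'_def)
    show "fst e \<noteq> snd e" if "e \<in> parcs W'" for e
    proof -
      from that obtain x where "x \<in> parcs W" "e = map_prod h h x"
        by (auto simp: W'_def)
      then obtain a b where ab: "(a, b) \<in> parcs W" "e = (h a, h b)"
        by (cases x) auto
      then show ?thesis
        using wellformed'[OF ab(1)] pair_no_loops[OF ab(1)] inj_onD[OF inj] by auto
    qed
    show "symmetric (with_proj W')"
      using pair_sym_arcs by (force simp: W'_def symmetric_def sym_def)
  qed
  then have "nonempty_graph W'"
    using W by (simp add: nonempty_graph_def W'_def)
  moreover have "independence_ratio G H W' = independence_ratio G H W"
  proof -
    have "pverts W' = h ` pverts W" by (simp add: W'_def)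
    note iso = independence_number_strong_product_iso[OF inj this arcs]
    show ?thesis by (simp only: independence_ratio_def iso)
  qed
  ultimately show ?thesis
    unfolding relative_fractional_independence_number_def
    by (metis (mono_tags, lifting) SUP_upper mem_Collect_eq)
qed

end

theory Submission
  imports Defs
begin

text \<open>
  The linear program in (i) and its dual, which is (iii) after normalisation, have integer data, so
  Farkas' lemma over the rationals provides optimal solutions \<open>w\<close>, \<open>p\<close> of the same
  value \<open>r\<close> with rational entries. The dual solution bounds every ratio: a map
  \<open>f \<in> \<F>(H, G)\<close> turns an independent set \<open>S\<close> of \<open>G \<boxtimes> W\<close> into the
  independent set \<open>\<Union>\<^bsub>(u, x) \<in> S\<^esub> f(u) \<times> {x}\<close> of \<open>H \<boxtimes> W\<close>; averaging
  its size over \<open>p\<close> gives \<open>\<alpha>(G \<boxtimes> W) \<le> r \<alpha>(H \<boxtimes> W)\<close>. The primal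
  solution produces an extremal \<open>W\<close>: if \<open>w\<^sub>i = a\<^sub>i / N\<close>, replace every vertex
  \<open>v\<^sub>i\<close> of the complement of \<open>G\<close> by \<open>a\<^sub>i\<close> pairwise non-adjacent copies. Then
  \<open>\<alpha>(G \<boxtimes> W) \<ge> \<Sum> a\<^sub>i\<close> by the diagonal, and \<open>\<alpha>(H \<boxtimes> W) \<le> N\<close>
  because keeping only the largest slice among the copies of each vertex yields a member of
  \<open>\<F>(H, G)\<close>.
\<close>

section \<open>Linear programming duality over an ordered field\<close>

text \<open>A pair \<open>(a, b)\<close> encodes the inequality \<open>\<Sum>\<^bsub>i\<^esub> a i * x i \<le> b\<close>.\<close>

inductive_set nonneg_combinations ::
    "(('i \<Rightarrow> 'k::linordered_field) \<times> 'k) set \<Rightarrow> (('i \<Rightarrow> 'k) \<times> 'k) set"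
  for C where
  generator: "c \<in> C \<Longrightarrow> c \<in> nonneg_combinations C"
| combine: "(a, b) \<in> nonneg_combinations C \<Longrightarrow> (a', b') \<in> nonneg_combinations C \<Longrightarrow>
    0 \<le> s \<Longrightarrow> 0 \<le> t \<Longrightarrow>
    (\<lambda>i. s * a i + t * a' i, s * b + t * b') \<in> nonneg_combinations C"

lemma nonneg_combinations_subset:
  assumes "C \<subseteq> nonneg_combinations D"
  shows "nonneg_combinations C \<subseteq> nonneg_combinations D"
proof
  fix c assume "c \<in> nonneg_combinations C"
  then show "c \<in> nonneg_combinations D"
    by induction (use assms in \<open>auto intro: nonneg_combinations.intros\<close>)
qed

text \<open>Supplies the value of an eliminated variable between its finitely many lower and upper
  bounds. Either set may be empty, and then only the other one constrains the choice.\<close>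

lemma finite_sets_separated:
  fixes L U :: "'k::linorder set"
  assumes "finite L" "finite U" "\<And>l u. l \<in> L \<Longrightarrow> u \<in> U \<Longrightarrow> l \<le> u"
  shows "\<exists>t. (\<forall>l\<in>L. l \<le> t) \<and> (\<forall>u\<in>U. t \<le> u)"
proof (cases "L = {}")
  case True
  show ?thesis using True Min_le[OF assms(2)] by blast
next
  case False
  then show ?thesis using assms Max_in[of L] Max_ge[of L] by blast
qed

text \<open>One step of Fourier--Motzkin elimination.\<close>

definition eliminate ::
    "'i \<Rightarrow> (('i \<Rightarrow> 'k::linordered_field) \<times> 'k) set \<Rightarrow> (('i \<Rightarrow> 'k) \<times> 'k) set" where
  "eliminate j C = {(a, b) \<in> C. a j = 0} \<union>
     (\<lambda>((a, b), (a', b')). (\<lambda>i. - a' j * a i + a j * a' i, - a' j * b + a j * b')) `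
       ({(a, b) \<in> C. 0 < a j} \<times> {(a, b) \<in> C. a j < 0})"

lemma finite_eliminate: "finite C \<Longrightarrow> finite (eliminate j C)"
  unfolding eliminate_def
  by (intro finite_UnI finite_imageI finite_cartesian_product) (auto elim!: rev_finite_subset)

text \<open>The multipliers \<open>- a' j\<close> and \<open>a j\<close> are positive by the choice
  of the two rows. Hence a certificate for the smaller system can be read as one for the original
  system.\<close>

lemma eliminate_subset: "eliminate j C \<subseteq> nonneg_combinations C"
proof -
  have "(\<lambda>i. a j * a' i - a' j * a i, a j * b' - a' j * b) \<in> nonneg_combinations C"
    if "(a, b) \<in> C" "0 < a j" "(a', b') \<in> C" "a' j < 0" for a b a' b'
    using combine[OF generator generator, of a b C a' b' "- a' j" "a j"] that by simp
  then show ?thesis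
    by (auto simp: eliminate_def intro: generator)
qed

lemma eliminate_coefficient:
  assumes "(a, b) \<in> nonneg_combinations (eliminate j C)"
  shows "a j = 0"
  using assms by (induction "(a, b)" arbitrary: a b) (auto simp: eliminate_def)

text \<open>A row with positive coefficient at \<open>j\<close> bounds the new value
  \<open>t\<close> from above by \<open>q\<close>, one with negative coefficient bounds it from
  below. The combined rows of \<open>eliminate j C\<close> say that every lower bound is at most
  every upper bound, so a common \<open>t\<close> exists.\<close>

lemma eliminate_solution:
  fixes C :: "(('i \<Rightarrow> 'k::linordered_field) \<times> 'k) set"
  assumes "finite I" "j \<notin> I" "finite C"
    and x: "\<forall>(a, b)\<in>eliminate j C. (\<Sum>i\<in>I. a i * x i) \<le> b"
  shows "\<exists>t. \<forall>(a, b)\<in>C. (\<Sum>i\<in>insert j I. a i * (x(j := t)) i) \<le> b"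
proof -
  define S where "S a = (\<Sum>i\<in>I. a i * x i)" for a
  define q where "q = (\<lambda>(a, b). (b - S a) / a j)"
  define P where "P = {(a, b) \<in> C. 0 < a j}"
  define N where "N = {(a, b) \<in> C. a j < 0}"
  have frac: "x / n \<le> y / p" if "p * x \<le> n * y" "0 < p" "0 < n" for x y n p :: 'k
    using that by (simp add: field_simps)
  have "finite P" "finite N"
    using \<open>finite C\<close> by (auto simp: P_def N_def elim!: rev_finite_subset)
  have "\<exists>t. (\<forall>l\<in>q ` N. l \<le> t) \<and> (\<forall>u\<in>q ` P. t \<le> u)"
  proof (rule finite_sets_separated)
    fix l u assume "l \<in> q ` N" "u \<in> q ` P"
    then obtain a b a' b' where ab: "(a, b) \<in> C" "0 < a j" "u = (b - S a) / a j"
      and ab': "(a', b') \<in> C" "a' j < 0" "l = (b' - S a') / a' j"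
      by (auto simp: q_def P_def N_def)
    have "(\<lambda>i. - a' j * a i + a j * a' i, - a' j * b + a j * b') \<in> eliminate j C"
      unfolding eliminate_def using ab ab' by (intro UnI2 image_eqI[where x = "((a, b), (a', b'))"]) auto
    with x have "(\<Sum>i\<in>I. (- a' j * a i + a j * a' i) * x i) \<le> - a' j * b + a j * b'"
      by fast
    also have "(\<Sum>i\<in>I. (- a' j * a i + a j * a' i) * x i) = - a' j * S a + a j * S a'"
      by (simp add: S_def sum_distrib_left sum.distrib[symmetric] algebra_simps)
    finally have "a j * (S a' - b') \<le> (- a' j) * (b - S a)"
      by (simp add: algebra_simps)
    \<comment> \<open>The fraction for the lower bound is written with both signs changed, so that
      its denominator is positive as \<open>frac\<close> requires.\<close>
    then have "(S a' - b') / (- a' j) \<le> (b - S a) / a j"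
      using ab ab' by (intro frac) auto
    moreover have "l = (S a' - b') / (- a' j)"
      using ab' by (simp add: field_simps)
    ultimately show "l \<le> u" using ab by simp
  qed (use \<open>finite P\<close> \<open>finite N\<close> in auto)
  then obtain t where t: "\<And>c. c \<in> N \<Longrightarrow> q c \<le> t" "\<And>c. c \<in> P \<Longrightarrow> t \<le> q c"
    by blast
  have "(\<Sum>i\<in>insert j I. a i * (x(j := t)) i) \<le> b" if ab: "(a, b) \<in> C" for a b
  proof -
    have eq: "(\<Sum>i\<in>insert j I. a i * (x(j := t)) i) = a j * t + S a"
      using assms(1,2) by (auto simp: S_def intro!: sum.cong)
    consider "a j = 0" | "0 < a j" | "a j < 0" by fastforce
    then have "a j * t + S a \<le> b"
    proof cases
      case 1
      then have "(a, b) \<in> eliminate j C" using ab by (simp add: eliminate_def)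
      with x 1 show ?thesis by (auto simp: S_def)
    next
      case 2
      then have "t \<le> (b - S a) / a j" using ab t(2)[of "(a, b)"] by (simp add: P_def q_def)
      with 2 show ?thesis by (simp add: field_simps)
    next
      case 3
      then have "(b - S a) / a j \<le> t" using ab t(1)[of "(a, b)"] by (simp add: N_def q_def)
      with 3 show ?thesis by (simp add: field_simps)
    qed
    with eq show ?thesis by simp
  qed
  then show ?thesis by blast
qed

text \<open>Induction on the variables. With no variable left, infeasibility exhibits a row with
  negative right-hand side. Otherwise the system without \<open>j\<close> is infeasible too, since a
  solution would extend, and its certificate has coefficient zero at \<open>j\<close>
  automatically.\<close>

lemma farkas:
  fixes C :: "(('i \<Rightarrow> 'k::linordered_field) \<times> 'k) set"
  assumes "finite I" "finite C" "\<nexists>x. \<forall>(a, b)\<in>C. (\<Sum>i\<in>I. a i * x i) \<le> b"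
  shows "\<exists>(a, b)\<in>nonneg_combinations C. (\<forall>i\<in>I. a i = 0) \<and> b < 0"
  using assms
proof (induction I arbitrary: C rule: finite_induct)
  case empty
  from empty.prems(2) have "\<exists>c\<in>C. snd c < 0"
    by (simp add: case_prod_beta not_le)
  then obtain c where c: "c \<in> C" "snd c < 0" ..
  show ?case
    by (rule bexI[of _ c]) (simp_all add: c case_prod_beta generator)
next
  case (insert j I)
  have "\<nexists>x. \<forall>(a, b)\<in>eliminate j C. (\<Sum>i\<in>I. a i * x i) \<le> b"
  proof
    assume "\<exists>x. \<forall>(a, b)\<in>eliminate j C. (\<Sum>i\<in>I. a i * x i) \<le> b"
    then obtain x where x: "\<forall>(a, b)\<in>eliminate j C. (\<Sum>i\<in>I. a i * x i) \<le> b" ..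
    from eliminate_solution[OF insert.hyps insert.prems(1) x] obtain t where
      "\<forall>(a, b)\<in>C. (\<Sum>i\<in>insert j I. a i * (x(j := t)) i) \<le> b" by (rule exE)
    then have "\<exists>x. \<forall>(a, b)\<in>C. (\<Sum>i\<in>insert j I. a i * x i) \<le> b"
      by (rule exI[of _ "x(j := t)"])
    with insert.prems(2) show False ..
  qed
  from insert.IH[OF finite_eliminate[OF insert.prems(1)] this] obtain a b where
    ab: "(a, b) \<in> nonneg_combinations (eliminate j C)" "\<forall>i\<in>I. a i = 0" "b < 0"
    by blast
  have "(a, b) \<in> nonneg_combinations C"
    using ab(1) nonneg_combinations_subset[OF eliminate_subset] by (rule rev_subsetD)
  then show ?case
    by (rule bexI[rotated]) (simp add: ab eliminate_coefficient[OF ab(1)])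
qed

section \<open>Duality of packing and covering programs\<close>

lemma sum_linear_combination:
  fixes g :: "'a \<Rightarrow> 'k::comm_semiring_0"
  shows "(\<Sum>x\<in>K. (s * g x + t * g' x) * h x) =
    s * (\<Sum>x\<in>K. g x * h x) + t * (\<Sum>x\<in>K. g' x * h x)"
  by (simp add: sum_distrib_left sum.distrib[symmetric] distrib_right mult.assoc)

text \<open>Double counting of \<open>w v * p f * A f v\<close> over all pairs. The bounds
  \<open>s\<close> and \<open>t\<close> are kept free because the argument is also applied to Farkas
  multipliers and to weights that are not normalised.\<close>

lemma packing_covering_weak_duality:
  fixes A :: "'f \<Rightarrow> 'v \<Rightarrow> 'k::linordered_field"
  assumes w: "\<And>v. v \<in> V \<Longrightarrow> 0 \<le> w v" "\<And>f. f \<in> F \<Longrightarrow> (\<Sum>v\<in>V. w v * A f v) \<le> s"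
    and p: "\<And>f. f \<in> F \<Longrightarrow> 0 \<le> p f" "\<And>v. v \<in> V \<Longrightarrow> t \<le> (\<Sum>f\<in>F. p f * A f v)"
  shows "t * (\<Sum>v\<in>V. w v) \<le> s * (\<Sum>f\<in>F. p f)"
proof -
  have "t * (\<Sum>v\<in>V. w v) \<le> (\<Sum>v\<in>V. w v * (\<Sum>f\<in>F. p f * A f v))"
    unfolding sum_distrib_left[of t] by (intro sum_mono) (use w p in \<open>simp add: mult.commute[of t] mult_left_mono\<close>)
  also have "\<dots> = (\<Sum>f\<in>F. p f * (\<Sum>v\<in>V. w v * A f v))"
    unfolding sum_distrib_left by (subst sum.swap) (simp add: ac_simps)
  also have "\<dots> \<le> s * (\<Sum>f\<in>F. p f)"
    unfolding sum_distrib_left[of s] by (intro sum_mono) (use w p in \<open>simp add: mult.commute[of s] mult_left_mono\<close>)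
  finally show ?thesis .
qed

text \<open>Farkas' lemma is applied to one joint system for both programs and the absence of a gap.
  A refutation amounts to multipliers \<open>y\<close> of the packing rows, \<open>z\<close> of the
  covering rows and \<open>s\<close> of the gap row, which by themselves form a covering and a
  packing with common bound \<open>s\<close> and values in the wrong order.\<close>

lemma packing_covering_strong_duality:
  fixes A :: "'f \<Rightarrow> 'v \<Rightarrow> 'k::linordered_field"
  assumes fin: "finite V" "finite F"
    and nonneg: "\<And>f v. f \<in> F \<Longrightarrow> v \<in> V \<Longrightarrow> 0 \<le> A f v"
    and covered: "\<And>v. v \<in> V \<Longrightarrow> \<exists>f\<in>F. 0 < A f v"
  obtains w p where "\<And>v. v \<in> V \<Longrightarrow> 0 \<le> w v" "\<And>f. f \<in> F \<Longrightarrow> (\<Sum>v\<in>V. w v * A f v) \<le> 1"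
    "\<And>f. f \<in> F \<Longrightarrow> 0 \<le> p f" "\<And>v. v \<in> V \<Longrightarrow> 1 \<le> (\<Sum>f\<in>F. p f * A f v)"
    "(\<Sum>v\<in>V. w v) = (\<Sum>f\<in>F. p f)"
proof -
  \<comment> \<open>A solution \<open>(w, p)\<close> of all inequalities in \<open>C\<close> is a pair of feasible points
    without duality gap. The rows \<open>pos\<close> only contribute the slack in \<open>certificate\<close>.\<close>
  define packing where "packing f = (case_sum (A f) (\<lambda>_. 0) :: 'v + 'f \<Rightarrow> 'k, 1::'k)" for f
  define covering where
    "covering v = (case_sum (\<lambda>_. 0) (\<lambda>f. - A f v) :: 'v + 'f \<Rightarrow> 'k, - 1::'k)" for v
  define gap where "gap = (case_sum (\<lambda>_. - 1) (\<lambda>_. 1) :: 'v + 'f \<Rightarrow> 'k, 0::'k)"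
  define pos where "pos i = ((\<lambda>j. if j = i then - 1 else 0) :: 'v + 'f \<Rightarrow> 'k, 0::'k)" for i
  define I where "I = V <+> F"
  define C where "C = packing ` F \<union> covering ` V \<union> {gap} \<union> pos ` I"
  have certificate: "\<exists>y z s. (\<forall>f\<in>F. 0 \<le> y f) \<and> (\<forall>v\<in>V. 0 \<le> z v) \<and> 0 \<le> s \<and>
      (\<forall>v\<in>V. a (Inl v) \<le> (\<Sum>f\<in>F. y f * A f v) - s) \<and>
      (\<forall>f\<in>F. a (Inr f) \<le> s - (\<Sum>v\<in>V. z v * A f v)) \<and>
      b = (\<Sum>f\<in>F. y f) - (\<Sum>v\<in>V. z v)"
    if "(a, b) \<in> nonneg_combinations C" for a b
    using that
  proof (induction "(a, b)" arbitrary: a b)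
    case generator
    then consider f where "f \<in> F" "(a, b) = packing f" | v where "v \<in> V" "(a, b) = covering v"
      | "(a, b) = gap" | i where "i \<in> I" "(a, b) = pos i"
      by (auto simp: C_def)
    then show ?case
    proof cases
      case 1
      then show ?thesis using fin
        by (intro exI[of _ "\<lambda>g. if g = f then 1 else 0"] exI[of _ "\<lambda>_. 0"] exI[of _ 0])
          (auto simp: packing_def if_distrib[of "\<lambda>x. x * _"] cong: if_cong)
    next
      case 2
      then show ?thesis using fin
        by (intro exI[of _ "\<lambda>_. 0"] exI[of _ "\<lambda>u. if u = v then 1 else 0"] exI[of _ 0])
          (auto simp: covering_def if_distrib[of "\<lambda>x. x * _"] cong: if_cong)
    next
      case 3
      then show ?thesis
        by (intro exI[of _ "\<lambda>_. 0"] exI[of _ "\<lambda>_. 0"] exI[of _ 1]) (auto simp: gap_def)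
    next
      case 4
      then show ?thesis
        by (intro exI[of _ "\<lambda>_. 0"] exI[of _ "\<lambda>_. 0"] exI[of _ 0]) (auto simp: pos_def)
    qed
  next
    case (combine a b a' b' s t)
    from combine(2) obtain y z r where 1: "\<forall>f\<in>F. 0 \<le> y f" "\<forall>v\<in>V. 0 \<le> z v" "0 \<le> r"
      "\<forall>v\<in>V. a (Inl v) \<le> (\<Sum>f\<in>F. y f * A f v) - r"
      "\<forall>f\<in>F. a (Inr f) \<le> r - (\<Sum>v\<in>V. z v * A f v)"
      "b = (\<Sum>f\<in>F. y f) - (\<Sum>v\<in>V. z v)" by blast
    from combine(4) obtain y' z' r' where 2: "\<forall>f\<in>F. 0 \<le> y' f" "\<forall>v\<in>V. 0 \<le> z' v" "0 \<le> r'"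
      "\<forall>v\<in>V. a' (Inl v) \<le> (\<Sum>f\<in>F. y' f * A f v) - r'"
      "\<forall>f\<in>F. a' (Inr f) \<le> r' - (\<Sum>v\<in>V. z' v * A f v)"
      "b' = (\<Sum>f\<in>F. y' f) - (\<Sum>v\<in>V. z' v)" by blast
    have le: "s * c + t * c' \<le> s * d + t * d'" if "c \<le> d" "c' \<le> d'" for c c' d d'
      using that combine(5,6) by (intro add_mono mult_left_mono)
    show ?case
    proof (intro exI[of _ "\<lambda>f. s * y f + t * y' f"] exI[of _ "\<lambda>v. s * z v + t * z' v"]
        exI[of _ "s * r + t * r'"] conjI ballI)
      show "s * a (Inl v) + t * a' (Inl v) \<le> (\<Sum>f\<in>F. (s * y f + t * y' f) * A f v) - (s * r + t * r')"
        if "v \<in> V" for v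
        using le[OF bspec[OF 1(4) that] bspec[OF 2(4) that]] unfolding sum_linear_combination by (simp add: algebra_simps)
      show "s * a (Inr f) + t * a' (Inr f) \<le> s * r + t * r' - (\<Sum>v\<in>V. (s * z v + t * z' v) * A f v)"
        if "f \<in> F" for f
        using le[OF bspec[OF 1(5) that] bspec[OF 2(5) that]] unfolding sum_linear_combination by (simp add: algebra_simps)
      show "s * b + t * b' = (\<Sum>f\<in>F. s * y f + t * y' f) - (\<Sum>v\<in>V. s * z v + t * z' v)"
        by (simp add: 1(6) 2(6) sum.distrib sum_distrib_left algebra_simps)
    qed (use 1(1-3) 2(1-3) combine(5,6) in auto)
  qed
  have "\<exists>x. \<forall>(a, b)\<in>C. (\<Sum>i\<in>I. a i * x i) \<le> b"
  proof (rule ccontr)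
    assume "\<not> ?thesis"
    moreover have "finite I" "finite C" using fin by (auto simp: I_def C_def)
    ultimately obtain a b where
      ab: "(a, b) \<in> nonneg_combinations C" "\<forall>i\<in>I. a i = 0" "b < 0"
      using farkas[of I C] by blast
    from certificate[OF ab(1)] obtain y z s where
      y: "\<forall>f\<in>F. 0 \<le> y f" and z: "\<forall>v\<in>V. 0 \<le> z v" and "0 \<le> s"
      and Inl: "\<forall>v\<in>V. a (Inl v) \<le> (\<Sum>f\<in>F. y f * A f v) - s"
      and Inr: "\<forall>f\<in>F. a (Inr f) \<le> s - (\<Sum>v\<in>V. z v * A f v)"
      and b: "b = (\<Sum>f\<in>F. y f) - (\<Sum>v\<in>V. z v)" by blast
    have cover: "\<forall>v\<in>V. s \<le> (\<Sum>f\<in>F. y f * A f v)"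
      and pack: "\<forall>f\<in>F. (\<Sum>v\<in>V. z v * A f v) \<le> s"
      using Inl Inr ab(2) by (simp_all add: I_def Plus_def)
    have less: "(\<Sum>f\<in>F. y f) < (\<Sum>v\<in>V. z v)" using ab(3) b by simp
    show False
    \<comment> \<open>For positive \<open>s\<close> this violates weak duality. For
      \<open>s = 0\<close> the multipliers \<open>z\<close> pack into capacity zero, while a
      positive \<open>z v\<close> contributes a positive amount to some row by
      \<open>covered\<close>.\<close>
    proof (cases "s = 0")
      case False
      have "s * (\<Sum>v\<in>V. z v) \<le> s * (\<Sum>f\<in>F. y f)"
        by (rule packing_covering_weak_duality[where A = A]) (use y z cover pack in auto)
      with False \<open>0 \<le> s\<close> less show False by simp
    next
      case True
      have "0 \<le> (\<Sum>f\<in>F. y f)" using y by (simp add: sum_nonneg)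
      with less have "(\<Sum>v\<in>V. z v) > 0" by simp
      then obtain v where v: "v \<in> V" "z v > 0"
        by (meson leD not_le sum_nonpos)
      with covered obtain f where f: "f \<in> F" "0 < A f v" by blast
      have "0 < z v * A f v" using v f by simp
      also have "\<dots> \<le> (\<Sum>v\<in>V. z v * A f v)"
        using v f z nonneg fin by (intro member_le_sum) auto
      also have "\<dots> \<le> 0" using pack f True by auto
      finally show False by simp
    qed
  qed
  then obtain x where x: "\<And>a b. (a, b) \<in> C \<Longrightarrow> (\<Sum>i\<in>I. a i * x i) \<le> b" by blast
  have split: "(\<Sum>i\<in>I. a i * x i) = (\<Sum>v\<in>V. a (Inl v) * x (Inl v)) + (\<Sum>f\<in>F. a (Inr f) * x (Inr f))" for a
    using fin by (simp add: I_def sum.Plus)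
  have pos: "0 \<le> x i" if "i \<in> I" for i
    using x[of "\<lambda>j. if j = i then - 1 else 0" 0] that fin
    by (simp add: C_def pos_def I_def if_distrib[of "\<lambda>x. x * _"] cong: if_cong)
  show ?thesis
  proof
    show 1: "0 \<le> x (Inl v)" if "v \<in> V" for v using pos that by (simp add: I_def InlI)
    show 3: "0 \<le> x (Inr f)" if "f \<in> F" for f using pos that by (simp add: I_def InrI)
    show 2: "(\<Sum>v\<in>V. x (Inl v) * A f v) \<le> 1" if "f \<in> F" for f
      using x[of "fst (packing f)" "snd (packing f)"] that
      by (simp add: C_def split) (simp add: packing_def mult.commute)
    show 4: "1 \<le> (\<Sum>f\<in>F. x (Inr f) * A f v)" if "v \<in> V" for v
      using x[of "fst (covering v)" "snd (covering v)"] that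
      by (simp add: C_def split) (simp add: covering_def mult.commute sum_negf)
    have "(\<Sum>f\<in>F. x (Inr f)) \<le> (\<Sum>v\<in>V. x (Inl v))"
      using x[of "fst gap" "snd gap"]
      by (simp add: C_def split) (simp add: gap_def sum_negf)
    moreover have "1 * (\<Sum>v\<in>V. x (Inl v)) \<le> 1 * (\<Sum>f\<in>F. x (Inr f))"
      by (rule packing_covering_weak_duality[where A = A]) (use 1 2 3 4 in auto)
    ultimately show "(\<Sum>v\<in>V. x (Inl v)) = (\<Sum>f\<in>F. x (Inr f))" by simp
  qed
qed

section \<open>Clearing denominators\<close>

text \<open>Turns rational weights into the numbers of copies used in the blow-up. The denominators
  are multiplied up one vertex at a time; values that are already natural stay so.\<close>

lemma common_denominator:
  fixes w :: "'a \<Rightarrow> rat"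
  assumes "finite V" "\<And>v. v \<in> V \<Longrightarrow> 0 \<le> w v"
  obtains N :: nat and a :: "'a \<Rightarrow> nat" where "0 < N" "\<And>v. v \<in> V \<Longrightarrow> w v * of_nat N = of_nat (a v)"
proof -
  have "\<exists>N>0. \<forall>v\<in>V. w v * of_nat N \<in> \<nat>"
    using assms
  proof (induction V rule: finite_induct)
    case (insert u V)
    then obtain N where N: "0 < N" "\<forall>v\<in>V. w v * of_nat N \<in> \<nat>" by auto
    obtain c d where cd: "quotient_of (w u) = (c, d)" by force
    have d: "d > 0" "w u = of_int c / of_int d"
      using cd quotient_of_denom_pos quotient_of_div by auto
    with insert.prems have "c \<ge> 0" by (force simp: zero_le_divide_iff)
    then have "w u * of_nat (N * nat d) = of_nat (N * nat c)"
      using d by simp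
    then have "w u * of_nat (N * nat d) \<in> \<nat>" by (metis of_nat_in_Nats)
    moreover have "w v * of_nat (N * nat d) \<in> \<nat>" if "v \<in> V" for v
      using N that Nats_mult[of "w v * of_nat N" "of_nat (nat d)"] by (simp add: mult.assoc)
    ultimately show ?case using N d by (intro exI[of _ "N * nat d"]) auto
  qed auto
  then obtain N where N: "0 < N" "\<forall>v\<in>V. w v * of_nat N \<in> \<nat>" by blast
  then have "\<forall>v\<in>V. \<exists>a. w v * of_nat N = of_nat a" by (metis Nats_cases)
  then have "\<exists>a. \<forall>v\<in>V. w v * of_nat N = of_nat (a v)" by (rule bchoice)
  with N(1) that show ?thesis by blast
qed

section \<open>Independent sets in strong products\<close>

lemma card_le_independence_number:
  assumes "finite (pverts G)" "S \<in> independent_sets G"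
  shows "card S \<le> independence_number G"
  unfolding independence_number_def
  using assms by (intro Max_ge finite_imageI finite_independent_sets imageI)

lemma independence_number_attained:
  assumes "finite (pverts G)"
  obtains S where "S \<in> independent_sets G" "card S = independence_number G"
proof -
  have "independence_number G \<in> card ` independent_sets G"
    unfolding independence_number_def
    using assms empty_in_independent_sets[of G]
    by (intro Max_in finite_imageI finite_independent_sets) auto
  with that show ?thesis by auto
qed

lemma pverts_strong_product [simp]: "pverts (G \<boxtimes> W) = pverts G \<times> pverts W"
  by (simp add: strong_product_def)

lemma parcs_strong_product:
  "((u, x), (u', x')) \<in> parcs (G \<boxtimes> W) \<longleftrightarrow>
     u \<in> pverts G \<and> u' \<in> pverts G \<and> x \<in> pverts W \<and> x' \<in> pverts W \<and> (u, x) \<noteq> (u', x') \<and>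
     (u = u' \<or> (u, u') \<in> parcs G) \<and> (x = x' \<or> (x, x') \<in> parcs W)"
  by (auto simp: strong_product_def)

text \<open>Independence in terms of closed neighbourhoods: equality and adjacency in a coordinate
  are treated alike, which spares case distinctions in the arguments on products.\<close>

lemma independent_sets_strong_productD:
  assumes "S \<in> independent_sets (G \<boxtimes> W)" "(u, x) \<in> S" "(u', x') \<in> S"
    and "u = u' \<or> (u, u') \<in> parcs G" "x = x' \<or> (x, x') \<in> parcs W"
  shows "u = u' \<and> x = x'"
  using assms by (fastforce simp: independent_sets_def parcs_strong_product)

lemma independent_sets_strong_productI:
  assumes "S \<subseteq> pverts G \<times> pverts W"
    and "\<And>u x u' x'. (u, x) \<in> S \<Longrightarrow> (u', x') \<in> S \<Longrightarrow> u = u' \<or> (u, u') \<in> parcs G \<Longrightarrow>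
      x = x' \<or> (x, x') \<in> parcs W \<Longrightarrow> u = u' \<and> x = x'"
  shows "S \<in> independent_sets (G \<boxtimes> W)"
  unfolding independent_sets_def using assms by (force simp: parcs_strong_product)

lemma finite_pverts:
  assumes "nonempty_graph G"
  shows "finite (pverts G)"
proof -
  interpret pair_graph G using assms by (simp add: nonempty_graph_def)
  show ?thesis by (rule pair_finite_verts)
qed

text \<open>Keeps the denominators of \<open>independence_ratio\<close> away from zero; a single
  vertex of the product suffices.\<close>

lemma independence_number_strong_product_pos:
  assumes "nonempty_graph H" "nonempty_graph W"
  shows "0 < independence_number (H \<boxtimes> W)"
proof -
  obtain y x where "y \<in> pverts H" "x \<in> pverts W"
    using assms by (auto simp: nonempty_graph_def)
  then have "{(y, x)} \<in> independent_sets (H \<boxtimes> W)"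
    by (intro independent_sets_strong_productI) auto
  moreover have "finite (pverts (H \<boxtimes> W))"
    using assms by (simp add: finite_pverts)
  ultimately have "card {(y, x)} \<le> independence_number (H \<boxtimes> W)"
    by (intro card_le_independence_number)
  then show ?thesis by simp
qed

section \<open>Transporting independent sets from \<open>G \<boxtimes> W\<close> to
  \<open>H \<boxtimes> W\<close>\<close>

text \<open>The sum is the size of the set \<open>T\<close> obtained by replacing each
  \<open>(u, x)\<close> in \<open>S\<close> by \<open>f u \<times> {x}\<close>. Distinct
  non-adjacent vertices of \<open>G\<close> have disconnected images, so points of \<open>T\<close>
  that are close in both coordinates come from close points of \<open>S\<close>, that is, from one
  point.\<close>

lemma sum_card_independent_set_map_le:
  assumes H: "finite (pverts H)" and W: "finite (pverts W)" and G: "finite (pverts G)"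
    and f: "f \<in> independent_set_maps H G" and S: "S \<in> independent_sets (G \<boxtimes> W)"
  shows "(\<Sum>(u, x)\<in>S. card (f u)) \<le> independence_number (H \<boxtimes> W)"
proof -
  define T where "T = (\<Union>(u, x)\<in>S. f u \<times> {x})"
  have S_sub: "u \<in> pverts G" "x \<in> pverts W" if "(u, x) \<in> S" for u x
    using S that by (auto simp: independent_sets_def)
  have f_indep: "f u \<in> independent_sets H" if "u \<in> pverts G" for u
    using f that by (auto simp: independent_set_maps_def)
  have f_sub: "f u \<subseteq> pverts H" if "u \<in> pverts G" for u
    using f_indep[OF that] by (simp add: independent_sets_def)
  have f_disc: "y \<noteq> y'" "(y, y') \<notin> parcs H"
    if "u \<in> pverts G" "u' \<in> pverts G" "u \<noteq> u'" "(u, u') \<notin> parcs G" "y \<in> f u" "y' \<in> f u'"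
    for u u' y y'
  proof -
    have "disconnected H (f u) (f u')"
      using f that(1-4) by (simp add: independent_set_maps_def)
    with that(5,6) show "y \<noteq> y'" "(y, y') \<notin> parcs H"
      by (auto simp: disconnected_def independent_sets_def)
  qed
  \<comment> \<open>Used twice: for the independence of \<open>T\<close> and, with
    \<open>y = y'\<close>, for the disjointness of its pieces.\<close>
  have same: "u = u' \<and> x = x'"
    if "(u, x) \<in> S" "(u', x') \<in> S" "y \<in> f u" "y' \<in> f u'" "y = y' \<or> (y, y') \<in> parcs H"
      "x = x' \<or> (x, x') \<in> parcs W" for u x u' x' y y'
  proof -
    have "u = u' \<or> (u, u') \<in> parcs G"
      using f_disc[of u u' y y'] that S_sub by blast
    then show ?thesis
      using independent_sets_strong_productD[OF S that(1,2)] that(6) by blast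
  qed
  have "T \<in> independent_sets (H \<boxtimes> W)"
  proof (rule independent_sets_strong_productI)
    show "T \<subseteq> pverts H \<times> pverts W" using S_sub f_sub unfolding T_def by blast
    fix y x y' x'
    assume T: "(y, x) \<in> T" "(y', x') \<in> T" and adj: "y = y' \<or> (y, y') \<in> parcs H"
      "x = x' \<or> (x, x') \<in> parcs W"
    then obtain u u' where u: "(u, x) \<in> S" "y \<in> f u" "(u', x') \<in> S" "y' \<in> f u'"
      by (auto simp: T_def)
    have eq: "u = u' \<and> x = x'" using same[OF u(1,3,2,4) adj] .
    \<comment> \<open>Both points now lie in one independent set \<open>f u\<close>, which leaves
      only equality.\<close>
    then have "(y, y') \<notin> parcs H"
      using f_indep[OF S_sub(1)[OF u(1)]] u by (auto simp: independent_sets_def)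
    with adj eq show "y = y' \<and> x = x'" by blast
  qed
  then have "card T \<le> independence_number (H \<boxtimes> W)"
    using H W by (intro card_le_independence_number) auto
  moreover have "card T = (\<Sum>c\<in>S. card (case c of (u, x) \<Rightarrow> f u \<times> {x}))"
    unfolding T_def
  proof (rule card_UN_disjoint)
    show "finite S" using S G W by (auto simp: independent_sets_def intro: finite_subset)
    show "\<forall>c\<in>S. finite (case c of (u, x) \<Rightarrow> f u \<times> {x})"
      by (auto intro!: finite_cartesian_product finite_subset[OF f_sub H] intro: S_sub(1))
    show "\<forall>c\<in>S. \<forall>d\<in>S. c \<noteq> d \<longrightarrow>
        (case c of (u, x) \<Rightarrow> f u \<times> {x}) \<inter> (case d of (u, x) \<Rightarrow> f u \<times> {x}) = {}"
      using same by blast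
  qed
  moreover have "(\<Sum>c\<in>S. card (case c of (u, x) \<Rightarrow> f u \<times> {x})) = (\<Sum>(u, x)\<in>S. card (f u))"
    by (auto simp: card_cartesian_product intro!: sum.cong)
  ultimately show ?thesis by simp
qed

text \<open>Take \<open>S\<close> of maximum size. The covering inequality at \<open>u\<close> gives
  every \<open>(u, x)\<close> in \<open>S\<close> weight at least 1; after exchanging the sums, the
  preceding lemma bounds the contribution of each \<open>f\<close>. The weights \<open>p\<close>
  need not add up to 1.\<close>

lemma independence_number_strong_product_le:
  assumes H: "finite (pverts H)" and W: "finite (pverts W)" and G: "finite (pverts G)"
    and p: "\<And>f. f \<in> independent_set_maps H G \<Longrightarrow> 0 \<le> p f"
      "\<And>u. u \<in> pverts G \<Longrightarrow> 1 \<le> (\<Sum>f\<in>independent_set_maps H G. p f * real (card (f u)))"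
  shows "real (independence_number (G \<boxtimes> W)) \<le>
    (\<Sum>f\<in>independent_set_maps H G. p f) * real (independence_number (H \<boxtimes> W))"
proof -
  let ?F = "independent_set_maps H G"
  have "finite (pverts (G \<boxtimes> W))" using G W by simp
  then obtain S where S: "S \<in> independent_sets (G \<boxtimes> W)" "card S = independence_number (G \<boxtimes> W)"
    by (rule independence_number_attained)
  have "real (card S) = (\<Sum>c\<in>S. 1)" by simp
  also have "\<dots> \<le> (\<Sum>c\<in>S. \<Sum>f\<in>?F. p f * real (card (f (fst c))))"
    using S(1) p(2) by (intro sum_mono) (auto simp: independent_sets_def)
  also have "\<dots> = (\<Sum>f\<in>?F. p f * real (\<Sum>(u, x)\<in>S. card (f u)))"
    by (subst sum.swap) (simp add: sum_distrib_left case_prod_beta)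
  also have "\<dots> \<le> (\<Sum>f\<in>?F. p f * real (independence_number (H \<boxtimes> W)))"
    using sum_card_independent_set_map_le[OF H W G _ S(1)] p(1)
    by (intro sum_mono mult_left_mono of_nat_mono) auto
  finally show ?thesis by (simp add: S(2) sum_distrib_right)
qed

section \<open>Blow-ups of the complement of \<open>G\<close>\<close>

text \<open>The colour \<open>c x\<close> tells of which vertex of \<open>G\<close> the element
  \<open>x\<close> is a copy, so the fibre sizes of \<open>c\<close> are the multiplicities.
  Requiring different colours makes copies of one vertex non-adjacent.\<close>

definition complement_blowup :: "('c \<Rightarrow> 'a) \<Rightarrow> 'c set \<Rightarrow> 'a pair_pre_digraph \<Rightarrow> 'c pair_pre_digraph"
  where "complement_blowup c X G =
    \<lparr> pverts = X, parcs = {(x, y) \<in> X \<times> X. c x \<noteq> c y \<and> (c x, c y) \<notin> parcs G} \<rparr>"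

lemma pair_graph_sym:
  assumes "pair_graph G" "(u, v) \<in> parcs G"
  shows "(v, u) \<in> parcs G"
proof -
  interpret pair_graph G by fact
  show ?thesis using pair_sym_arcs assms(2) by (auto simp: symmetric_def sym_def)
qed

lemma nonempty_graph_complement_blowup:
  assumes "pair_graph G" "finite X" "X \<noteq> {}"
  shows "nonempty_graph (complement_blowup c X G)"
proof -
  let ?W = "complement_blowup c X G"
  have "pair_graph ?W"
  proof
    show "fst e \<in> pverts ?W" "snd e \<in> pverts ?W" "fst e \<noteq> snd e" if "e \<in> parcs ?W" for e
      using that by (auto simp: complement_blowup_def)
    show "finite (pverts ?W)" using assms(2) by (simp add: complement_blowup_def)
    have "parcs ?W \<subseteq> X \<times> X" by (auto simp: complement_blowup_def)
    then show "finite (parcs ?W)" using assms(2) by (auto intro: finite_subset)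
    show "symmetric (with_proj ?W)"
      using pair_graph_sym[OF assms(1)]
      by (auto simp: complement_blowup_def symmetric_def sym_def)
  qed
  then show ?thesis using assms(3) by (simp add: nonempty_graph_def complement_blowup_def)
qed

text \<open>The diagonal points \<open>(c x, x)\<close> are independent: adjacency of
  \<open>x\<close> and \<open>y\<close> in the blow-up forces \<open>c x\<close> and
  \<open>c y\<close> to be distinct and non-adjacent in \<open>G\<close>.\<close>

lemma card_le_independence_number_complement_blowup:
  assumes "finite (pverts G)" "finite X" "c ` X \<subseteq> pverts G"
  shows "card X \<le> independence_number (G \<boxtimes> complement_blowup c X G)"
proof -
  have "(\<lambda>x. (c x, x)) ` X \<in> independent_sets (G \<boxtimes> complement_blowup c X G)"
    using assms(3) by (intro independent_sets_strong_productI) (auto simp: complement_blowup_def)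
  then have "card ((\<lambda>x. (c x, x)) ` X) \<le> independence_number (G \<boxtimes> complement_blowup c X G)"
    using assms(1,2) by (intro card_le_independence_number) (auto simp: complement_blowup_def)
  then show ?thesis by (simp add: card_image inj_on_def)
qed

text \<open>Cut a maximum independent set \<open>T\<close> into its slices over \<open>X\<close>.
  Slices over adjacent vertices of the blow-up are disconnected in \<open>H\<close>. Replacing each
  slice by a largest one of the same colour does not decrease the total size and yields a map
  \<open>f\<close> to which \<open>bound\<close> applies.\<close>

lemma independence_number_complement_blowup_le:
  assumes G: "pair_graph G" and H: "pair_graph H" and X: "finite X" "c ` X \<subseteq> pverts G"
    and bound: "\<And>f. f \<in> independent_set_maps H G \<Longrightarrow> (\<Sum>x\<in>X. card (f (c x))) \<le> N"
  shows "independence_number (H \<boxtimes> complement_blowup c X G) \<le> N"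
proof -
  interpret H: pair_graph H by fact
  let ?W = "complement_blowup c X G"
  have vW: "pverts ?W = X" by (simp add: complement_blowup_def)
  have "finite (pverts (H \<boxtimes> ?W))" using X H.pair_finite_verts by (simp add: vW)
  then obtain T where T: "T \<in> independent_sets (H \<boxtimes> ?W)" "card T = independence_number (H \<boxtimes> ?W)"
    by (rule independence_number_attained)
  define slice where "slice x = {y. (y, x) \<in> T}" for x
  have slice_sub: "slice x \<subseteq> pverts H" for x
    using T(1) by (auto simp: slice_def independent_sets_def)
  have separated: "y \<noteq> y' \<and> (y, y') \<notin> parcs H"
    if "y \<in> slice x" "y' \<in> slice x'" "(x, x') \<in> parcs ?W" for x x' y y'
    using independent_sets_strong_productD[OF T(1), of y x y' x'] that
    by (auto simp: slice_def complement_blowup_def)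
  have slice_indep: "slice x \<in> independent_sets H" for x
    using independent_sets_strong_productD[OF T(1), of _ x _ x] slice_sub[of x] H.pair_no_loops
    by (fastforce simp: slice_def independent_sets_def)
  have "\<exists>x. x \<in> X \<and> c x = u \<and> (\<forall>y\<in>X. c y = u \<longrightarrow> card (slice y) \<le> card (slice x))"
    if "u \<in> c ` X" for u
  proof -
    let ?K = "(\<lambda>x. card (slice x)) ` {x \<in> X. c x = u}"
    have "finite ?K" "?K \<noteq> {}" using X that by auto
    then have "Max ?K \<in> ?K" "\<And>k. k \<in> ?K \<Longrightarrow> k \<le> Max ?K" by (auto intro: Max_in)
    then show ?thesis by fastforce
  qed
  then obtain r where r: "\<And>u. u \<in> c ` X \<Longrightarrow> r u \<in> X" "\<And>u. u \<in> c ` X \<Longrightarrow> c (r u) = u"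
    and r_max: "\<And>x. x \<in> X \<Longrightarrow> card (slice x) \<le> card (slice (r (c x)))"
    by (metis imageI)
  \<comment> \<open>Vertices of \<open>G\<close> without a copy in \<open>X\<close> receive the
    empty set, which is disconnected from every independent set.\<close>
  define f where "f = (\<lambda>u\<in>pverts G. if u \<in> c ` X then slice (r u) else {})"
  have "disconnected H (f u) (f v)"
    if uv: "u \<in> pverts G" "v \<in> pverts G" "u \<noteq> v" "(u, v) \<notin> parcs G" for u v
  proof (cases "u \<in> c ` X \<and> v \<in> c ` X")
    case True
    have "(v, u) \<notin> parcs G" using uv(4) pair_graph_sym[OF G] by blast
    \<comment> \<open>Both orientations are recorded because independence of the union speaks about
      ordered pairs.\<close>
    then have "(r u, r v) \<in> parcs ?W" "(r v, r u) \<in> parcs ?W"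
      using True r[of u] r[of v] uv by (simp_all add: complement_blowup_def)
    note sep = separated[OF _ _ this(1)] separated[OF _ _ this(2)]
    have "slice (r u) \<union> slice (r v) \<in> independent_sets H"
      using slice_indep[of "r u"] slice_indep[of "r v"] sep
      unfolding independent_sets_def by blast
    moreover have "slice (r u) \<inter> slice (r v) = {}" using sep by blast
    ultimately show ?thesis using True uv by (simp add: f_def disconnected_def)
  next
    case False
    then show ?thesis
      using uv slice_indep empty_in_independent_sets[of H] by (auto simp: f_def disconnected_def)
  qed
  then have f: "f \<in> independent_set_maps H G"
    unfolding independent_set_maps_def
    using slice_indep empty_in_independent_sets[of H] by (auto simp: f_def)
  have "T = prod.swap ` Sigma X slice"
    using T(1) by (fastforce simp: slice_def independent_sets_def vW image_iff)
  then have "card T = card (Sigma X slice)" by (simp add: card_image)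
  also have "\<dots> = (\<Sum>x\<in>X. card (slice x))"
    using X finite_subset[OF slice_sub H.pair_finite_verts] by (intro card_SigmaI) auto
  also have "\<dots> \<le> (\<Sum>x\<in>X. card (f (c x)))"
    using r_max X(2) by (intro sum_mono) (auto simp: f_def)
  also have "\<dots> \<le> N" using bound[OF f] .
  finally show ?thesis using T(2) by simp
qed

section \<open>Distributions with prescribed weights\<close>

lemma pmf_of_weights:
  assumes "finite A" "\<And>a. a \<in> A \<Longrightarrow> 0 \<le> p a" "(\<Sum>a\<in>A. p a) = 1"
  obtains q where "set_pmf q \<subseteq> A" "\<And>a. a \<in> A \<Longrightarrow> pmf q a = p a"
proof -
  \<comment> \<open>Extension by zero, since \<open>embed_pmf\<close> expects a density on the whole
    type.\<close>
  define p' where "p' a = (if a \<in> A then p a else 0)" for a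
  have nonneg: "0 \<le> p' a" for a using assms(2) by (simp add: p'_def)
  have "(\<integral>\<^sup>+a. ennreal (p' a) \<partial>count_space UNIV) = (\<integral>\<^sup>+a. ennreal (p a) \<partial>count_space A)"
    by (subst nn_integral_count_space_indicator[of A])
      (auto simp: p'_def indicator_def intro!: nn_integral_cong)
  also have "\<dots> = 1"
    using assms by (simp add: nn_integral_count_space_finite sum_ennreal)
  finally have prob: "(\<integral>\<^sup>+a. ennreal (p' a) \<partial>count_space UNIV) = 1" .
  show ?thesis
  proof
    show "set_pmf (embed_pmf p') \<subseteq> A"
      unfolding set_embed_pmf[OF nonneg prob] by (auto simp: p'_def split: if_splits)
    show "pmf (embed_pmf p') a = p a" if "a \<in> A" for a
      unfolding pmf_embed_pmf[OF nonneg prob] using that by (simp add: p'_def)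
  qed
qed

section \<open>The relative fractional independence number\<close>

text \<open>With \<open>w u = a u / N\<close>, a blow-up with \<open>a u\<close> copies of each
  \<open>u\<close> has \<open>n\<close> vertices, where \<open>n / N\<close> is the total weight.
  The diagonal bounds the numerator of its ratio below by \<open>n\<close>; feasibility of
  \<open>w\<close>, multiplied by \<open>N\<close>, bounds the denominator above by
  \<open>N\<close>.\<close>

lemma fractional_optimum_attained:
  fixes G :: "'a pair_pre_digraph" and H :: "'b pair_pre_digraph" and w :: "'a \<Rightarrow> rat"
  assumes G: "nonempty_graph G" and H: "nonempty_graph H"
    and nonneg: "\<And>u. u \<in> pverts G \<Longrightarrow> 0 \<le> w u" and pos: "0 < (\<Sum>u\<in>pverts G. w u)"
    and feasible: "\<And>f. f \<in> independent_set_maps H G \<Longrightarrow>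
      (\<Sum>u\<in>pverts G. w u * of_nat (card (f u))) \<le> 1"
  obtains W :: "nat pair_pre_digraph" where "nonempty_graph W"
    "real_of_rat (\<Sum>u\<in>pverts G. w u) \<le> independence_ratio G H W"
proof -
  note fin = finite_pverts[OF G]
  obtain N a where N: "0 < N" and a: "\<And>u. u \<in> pverts G \<Longrightarrow> w u * of_nat N = of_nat (a u)"
    by (rule common_denominator[of "pverts G" w]) (use fin nonneg in auto)
  \<comment> \<open>The copies are pairs of a vertex and an index; the enumeration \<open>h\<close>
    renames them to natural numbers, as the type of \<open>W\<close> demands.\<close>
  define D where "D = (SIGMA u:pverts G. {..<a u})"
  define n where "n = card D"
  have "finite D" using fin by (auto simp: D_def)
  then obtain h where h: "bij_betw h {0..<n} D"
    unfolding n_def by (rule ex_bij_betw_nat_finite[THEN exE])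
  define W where "W = complement_blowup (fst \<circ> h) {0..<n} G"
  have colours: "(fst \<circ> h) ` {0..<n} \<subseteq> pverts G"
    unfolding image_comp[symmetric] bij_betw_imp_surj_on[OF h] by (auto simp: D_def)
  have n: "of_nat n = of_nat N * (\<Sum>u\<in>pverts G. w u)"
    using fin by (simp add: n_def D_def a[symmetric] sum_distrib_left mult.commute)
  \<comment> \<open>A positive total weight ensures that the blow-up has a vertex at all.\<close>
  then have "rat_of_nat n > 0" using N pos by simp
  then have "n > 0" by simp
  have W: "nonempty_graph W"
    unfolding W_def using G \<open>n > 0\<close>
    by (intro nonempty_graph_complement_blowup) (auto simp: nonempty_graph_def)
  have "n \<le> independence_number (G \<boxtimes> W)"
    using card_le_independence_number_complement_blowup[OF fin _ colours] by (simp add: W_def)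
  moreover have "independence_number (H \<boxtimes> W) \<le> N"
    unfolding W_def
  proof (rule independence_number_complement_blowup_le[OF _ _ _ colours])
    fix f assume f: "f \<in> independent_set_maps H G"
    have "(\<Sum>x\<in>{0..<n}. card (f ((fst \<circ> h) x))) = (\<Sum>c\<in>D. card (f (fst c)))"
      using sum.reindex_bij_betw[OF h, of "\<lambda>c. card (f (fst c))"] by simp
    also have "\<dots> = (\<Sum>u\<in>pverts G. a u * card (f u))"
      using sum.Sigma[of "pverts G" "\<lambda>u. {..<a u}" "\<lambda>u _. card (f u)"] fin
      by (simp add: D_def case_prod_beta)
    finally have "rat_of_nat (\<Sum>x\<in>{0..<n}. card (f ((fst \<circ> h) x))) =
        of_nat N * (\<Sum>u\<in>pverts G. w u * of_nat (card (f u)))"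
      by (simp add: a[symmetric] sum_distrib_left ac_simps)
    also have "\<dots> \<le> of_nat N"
      using mult_left_mono[OF feasible[OF f], of "of_nat N"] by simp
    finally show "(\<Sum>x\<in>{0..<n}. card (f ((fst \<circ> h) x))) \<le> N"
      by (simp only: of_nat_le_iff)
  qed (use G H in \<open>auto simp: nonempty_graph_def\<close>)
  moreover have "0 < independence_number (H \<boxtimes> W)"
    using independence_number_strong_product_pos[OF H W] .
  ultimately have "real n / real N \<le> independence_ratio G H W"
    unfolding independence_ratio_def by (intro frac_le) auto
  moreover have "real_of_rat (\<Sum>u\<in>pverts G. w u) = real n / real N"
  proof -
    have "(\<Sum>u\<in>pverts G. w u) = of_nat n / of_nat N" using n N by simp
    then show ?thesis by (simp add: of_rat_divide)
  qed
  ultimately show ?thesis using that W by simp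
qed

lemma independence_ratio_upper_bound:
  assumes G: "nonempty_graph G" and H: "nonempty_graph H" and W: "nonempty_graph W"
    and p: "\<And>f. f \<in> independent_set_maps H G \<Longrightarrow> 0 \<le> p f"
      "\<And>u. u \<in> pverts G \<Longrightarrow> 1 \<le> (\<Sum>f\<in>independent_set_maps H G. p f * real (card (f u)))"
  shows "independence_ratio G H W \<le> (\<Sum>f\<in>independent_set_maps H G. p f)"
proof -
  have "0 < independence_number (H \<boxtimes> W)"
    by (rule independence_number_strong_product_pos[OF H W])
  moreover have "real (independence_number (G \<boxtimes> W)) \<le>
      (\<Sum>f\<in>independent_set_maps H G. p f) * real (independence_number (H \<boxtimes> W))"
    by (rule independence_number_strong_product_le) (use assms finite_pverts in auto)
  ultimately show ?thesis by (simp add: independence_ratio_def pos_divide_le_eq)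
qed

text \<open>Primal weights \<open>w\<close>, unnormalised dual weights \<open>p\<close> and a graph
  \<open>W\<close>, all of the same value \<open>r\<close>; every part of the theorem is read off
  from these. Duality is applied over the rationals so that denominators can be cleared, and the
  solutions are then embedded into the reals.\<close>

lemma relative_fractional_independence_number_duality:
  fixes G :: "'a pair_pre_digraph" and H :: "'b pair_pre_digraph"
  assumes G: "nonempty_graph G" and H: "nonempty_graph H"
  obtains r :: real and w :: "'a \<Rightarrow> real" and p :: "('a \<Rightarrow> 'b set) \<Rightarrow> real"
    and W :: "nat pair_pre_digraph" where
    "0 < r" "relative_fractional_independence_number G H = ereal r"
    "\<And>u. u \<in> pverts G \<Longrightarrow> 0 \<le> w u" "(\<Sum>u\<in>pverts G. w u) = r"
    "\<And>f. f \<in> independent_set_maps H G \<Longrightarrow> (\<Sum>u\<in>pverts G. w u * real (card (f u))) \<le> 1"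
    "\<And>f. f \<in> independent_set_maps H G \<Longrightarrow> 0 \<le> p f" "(\<Sum>f\<in>independent_set_maps H G. p f) = r"
    "\<And>u. u \<in> pverts G \<Longrightarrow> 1 \<le> (\<Sum>f\<in>independent_set_maps H G. p f * real (card (f u)))"
    "nonempty_graph W" "independence_ratio G H W = r"
proof -
  let ?F = "independent_set_maps H G"
  note finG = finite_pverts[OF G] and finH = finite_pverts[OF H]
  note finF = finite_independent_set_maps[OF finG finH]
  have covered: "\<exists>f\<in>?F. 0 < rat_of_nat (card (f u))" if "u \<in> pverts G" for u
  proof -
    interpret H: pair_graph H using H by (simp add: nonempty_graph_def)
    obtain y where "y \<in> pverts H" using H by (auto simp: nonempty_graph_def)
    then have "{y} \<in> independent_sets H"
      by (auto simp: independent_sets_def dest: H.pair_no_loops)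
    \<comment> \<open>A singleton at \<open>u\<close> and the empty set elsewhere: column
      \<open>u\<close> of the program has a positive entry.\<close>
    then have "(\<lambda>u'\<in>pverts G. if u' = u then {y} else {}) \<in> ?F"
      by (auto simp: independent_set_maps_def disconnected_def empty_in_independent_sets)
    then show ?thesis using that by (rule_tac bexI) auto
  qed
  obtain w p where
    w: "\<And>u. u \<in> pverts G \<Longrightarrow> 0 \<le> w u"
      "\<And>f. f \<in> ?F \<Longrightarrow> (\<Sum>u\<in>pverts G. w u * rat_of_nat (card (f u))) \<le> 1"
    and p: "\<And>f. f \<in> ?F \<Longrightarrow> 0 \<le> p f"
      "\<And>u. u \<in> pverts G \<Longrightarrow> 1 \<le> (\<Sum>f\<in>?F. p f * rat_of_nat (card (f u)))"
    and eq: "(\<Sum>u\<in>pverts G. w u) = (\<Sum>f\<in>?F. p f)"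
    by (rule packing_covering_strong_duality[where A = "\<lambda>f u. rat_of_nat (card (f u))"
          and V = "pverts G" and F = ?F])
      (use finG finF covered in auto)
  let ?w = "\<lambda>u. real_of_rat (w u)" and ?p = "\<lambda>f. real_of_rat (p f)"
  define r where "r = real_of_rat (\<Sum>u\<in>pverts G. w u)"
  have real_w: "(\<Sum>u\<in>pverts G. ?w u * real (card (f u))) \<le> 1" if "f \<in> ?F" for f
  proof -
    have "(\<Sum>u\<in>pverts G. ?w u * real (card (f u))) =
        real_of_rat (\<Sum>u\<in>pverts G. w u * rat_of_nat (card (f u)))"
      by (simp add: of_rat_sum of_rat_mult)
    also have "\<dots> \<le> 1" using w(2)[OF that] by simp
    finally show ?thesis .
  qed
  have real_p: "1 \<le> (\<Sum>f\<in>?F. ?p f * real (card (f u)))" if "u \<in> pverts G" for u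
  proof -
    have "1 \<le> real_of_rat (\<Sum>f\<in>?F. p f * rat_of_nat (card (f u)))" using p(2)[OF that] by simp
    also have "\<dots> = (\<Sum>f\<in>?F. ?p f * real (card (f u)))"
      by (simp add: of_rat_sum of_rat_mult)
    finally show ?thesis .
  qed
  have sum_p: "(\<Sum>f\<in>?F. ?p f) = r" by (simp add: r_def eq of_rat_sum)
  \<comment> \<open>Value zero would make all of \<open>p\<close> vanish, against the covering
    inequality at any vertex.\<close>
  have "r \<noteq> 0"
  proof
    assume "r = 0"
    then have "\<forall>f\<in>?F. p f = 0"
      using eq p(1) finF by (simp add: r_def sum_nonneg_eq_0_iff)
    moreover obtain u where "u \<in> pverts G" using G by (auto simp: nonempty_graph_def)
    ultimately show False using p(2)[of u] by simp
  qed
  moreover have "0 \<le> r" by (simp add: r_def sum_nonneg w)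
  ultimately have "0 < r" by simp
  then have "0 < (\<Sum>u\<in>pverts G. w u)" by (simp add: r_def)
  then obtain W :: "nat pair_pre_digraph" where W: "nonempty_graph W" "r \<le> independence_ratio G H W"
    using fractional_optimum_attained[OF G H w(1) _ w(2)] unfolding r_def by blast
  have upper: "independence_ratio G H W' \<le> r" if "nonempty_graph W'" for W' :: "nat pair_pre_digraph"
    using independence_ratio_upper_bound[OF G H that, of ?p] p(1) real_p sum_p by simp
  have "relative_fractional_independence_number G H \<le> ereal r"
    unfolding relative_fractional_independence_number_def by (intro SUP_least) (simp add: upper)
  moreover have ratio: "independence_ratio G H W = r" using W upper by fastforce
  then have "ereal r \<le> relative_fractional_independence_number G H"
    using independence_ratio_le[OF W(1), of G H] by simp
  ultimately have "relative_fractional_independence_number G H = ereal r" by simp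
  moreover have "(\<Sum>u\<in>pverts G. ?w u) = r" by (simp add: r_def of_rat_sum)
  moreover have "0 \<le> ?w u" if "u \<in> pverts G" for u using w(1)[OF that] by simp
  moreover have "0 \<le> ?p f" if "f \<in> ?F" for f using p(1)[OF that] by simp
  ultimately show ?thesis
    using \<open>0 < r\<close> real_w real_p sum_p W(1) ratio by (intro that[of r ?w ?p W])
qed

section \<open>Indexed families and the four characterisations\<close>

text \<open>Maps and families correspond by composition with \<open>v\<close> and its inverse.
  \<open>P\<close> is applied to restrictions because a family \<open>T\<close> is arbitrary outside
  \<open>J\<close>.\<close>

lemma independent_set_map_iff_family:
  assumes v: "bij_betw v J (pverts G)"
  shows "(\<forall>f\<in>independent_set_maps H G. P (\<lambda>i\<in>J. f (v i))) \<longleftrightarrow>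
    (\<forall>T. (\<forall>i\<in>J. T i \<in> independent_sets H) \<and>
      (\<forall>i\<in>J. \<forall>j\<in>J. i \<noteq> j \<and> (v i, v j) \<notin> parcs G \<longrightarrow> disconnected H (T i) (T j)) \<longrightarrow>
      P (\<lambda>i\<in>J. T i))"
proof (intro iffI ballI allI impI)
  fix T
  assume P: "\<forall>f\<in>independent_set_maps H G. P (\<lambda>i\<in>J. f (v i))"
    and T: "(\<forall>i\<in>J. T i \<in> independent_sets H) \<and>
      (\<forall>i\<in>J. \<forall>j\<in>J. i \<noteq> j \<and> (v i, v j) \<notin> parcs G \<longrightarrow> disconnected H (T i) (T j))"
  define u where "u = inv_into J v"
  have u: "u x \<in> J" "v (u x) = x" if "x \<in> pverts G" for x
    using v that by (auto simp: u_def bij_betw_def inv_into_into f_inv_into_f)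
  have uv: "u (v i) = i" if "i \<in> J" for i
    using v that by (simp add: u_def bij_betw_inv_into_left)
  have "(\<lambda>x\<in>pverts G. T (u x)) \<in> independent_set_maps H G"
    unfolding independent_set_maps_def
  proof (intro CollectI conjI ballI impI)
    fix x y assume xy: "x \<in> pverts G" "y \<in> pverts G" "x \<noteq> y" "(x, y) \<notin> parcs G"
    then have "u x \<noteq> u y" using u by metis
    then show "disconnected H ((\<lambda>x\<in>pverts G. T (u x)) x) ((\<lambda>x\<in>pverts G. T (u x)) y)"
      using T xy u by simp
  qed (use T u in auto)
  moreover have "(\<lambda>i\<in>J. (\<lambda>x\<in>pverts G. T (u x)) (v i)) = (\<lambda>i\<in>J. T i)"
    by (rule restrict_ext) (use v uv in \<open>auto simp: bij_betw_def\<close>)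
  ultimately show "P (\<lambda>i\<in>J. T i)" using P by metis
next
  fix f
  assume P: "\<forall>T. (\<forall>i\<in>J. T i \<in> independent_sets H) \<and>
      (\<forall>i\<in>J. \<forall>j\<in>J. i \<noteq> j \<and> (v i, v j) \<notin> parcs G \<longrightarrow> disconnected H (T i) (T j)) \<longrightarrow>
      P (\<lambda>i\<in>J. T i)"
    and f: "f \<in> independent_set_maps H G"
  have "v i \<in> pverts G" if "i \<in> J" for i using v that by (auto simp: bij_betw_def)
  moreover have "v i \<noteq> v j" if "i \<in> J" "j \<in> J" "i \<noteq> j" for i j
    using v that by (auto simp: bij_betw_def inj_on_def)
  ultimately show "P (\<lambda>i\<in>J. f (v i))"
    using P[rule_format, of "\<lambda>i. f (v i)"] f by (auto simp: independent_set_maps_def)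
qed

theorem theorem2:
  fixes G :: "'a pair_pre_digraph" and H :: "'b pair_pre_digraph"
    and v :: "nat \<Rightarrow> 'a" and k :: nat
  assumes G: "nonempty_graph G"
    and H: "nonempty_graph H"
    and v: "bij_betw v {1..k} (pverts G)"
  shows
    "is_maximum
       {ereal (\<Sum>i = 1..k. w i) | w :: nat \<Rightarrow> real.
          (\<forall>i\<in>{1..k}. 0 \<le> w i) \<and>
          (\<forall>f\<in>independent_set_maps H G. (\<Sum>i = 1..k. w i * real (card (f (v i)))) \<le> 1)}
       (relative_fractional_independence_number G H)
     \<and> (\<forall>w :: nat \<Rightarrow> real. (\<forall>i\<in>{1..k}. 0 \<le> w i) \<longrightarrow>
          ((\<forall>f\<in>independent_set_maps H G. (\<Sum>i = 1..k. w i * real (card (f (v i)))) \<le> 1) \<longleftrightarrow>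
           (\<forall>T :: nat \<Rightarrow> 'b set.
              (\<forall>i\<in>{1..k}. T i \<in> independent_sets H) \<and>
              (\<forall>i\<in>{1..k}. \<forall>j\<in>{1..k}.
                 i \<noteq> j \<and> (v i, v j) \<notin> parcs G \<longrightarrow> disconnected H (T i) (T j)) \<longrightarrow>
              (\<Sum>i = 1..k. w i * real (card (T i))) \<le> 1)))
     \<and> is_minimum
         {ereal (Max ((\<lambda>f. \<Sum>i = 1..k. w i * real (card (f (v i)))) ` independent_set_maps H G))
          | w :: nat \<Rightarrow> real. (\<forall>i\<in>{1..k}. 0 \<le> w i) \<and> (\<Sum>i = 1..k. w i) = 1}
         (1 / relative_fractional_independence_number G H)
     \<and> is_minimum
         {Max ((\<lambda>u. 1 / ereal (measure_pmf.expectation p (\<lambda>F. real (card (F u))))) ` pverts G)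
          | p :: ('a \<Rightarrow> 'b set) pmf. set_pmf p \<subseteq> independent_set_maps H G}
         (relative_fractional_independence_number G H)
     \<and> (\<exists>W :: nat pair_pre_digraph. nonempty_graph W \<and>
          relative_fractional_independence_number G H = ereal (independence_ratio G H W))"
proof (intro conjI)
  let ?F = "independent_set_maps H G"
  obtain r w p and W :: "nat pair_pre_digraph" where
    r: "0 < r" "relative_fractional_independence_number G H = ereal r"
    and w: "\<And>u. u \<in> pverts G \<Longrightarrow> 0 \<le> w u" "(\<Sum>u\<in>pverts G. w u) = r"
      "\<And>f. f \<in> ?F \<Longrightarrow> (\<Sum>u\<in>pverts G. w u * real (card (f u))) \<le> 1"
    and p: "\<And>f. f \<in> ?F \<Longrightarrow> 0 \<le> p f" "(\<Sum>f\<in>?F. p f) = r"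
      "\<And>u. u \<in> pverts G \<Longrightarrow> 1 \<le> (\<Sum>f\<in>?F. p f * real (card (f u)))"
    and W: "nonempty_graph W" "independence_ratio G H W = r"
    by (rule relative_fractional_independence_number_duality[OF G H], rule that)
  note finG = finite_pverts[OF G] and finH = finite_pverts[OF H]
  note finF = finite_independent_set_maps[OF finG finH]
  have v_in: "v i \<in> pverts G" if "i \<in> {1..k}" for i
    using v that by (auto simp: bij_betw_def)
  have reindex: "(\<Sum>i = 1..k. g (v i)) = (\<Sum>u\<in>pverts G. g u)" for g :: "'a \<Rightarrow> real"
    by (rule sum.reindex_bij_betw[OF v])
  \<comment> \<open>Weak duality against the fixed dual solution \<open>p\<close>. Taking
    \<open>s = 1\<close> gives optimality in (i); taking \<open>s\<close> to be the maximum over all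
    maps gives the lower bound in (ii).\<close>
  have weak: "(\<Sum>i = 1..k. x i) \<le> s * r"
    if "\<forall>i\<in>{1..k}. 0 \<le> x i" "\<forall>f\<in>?F. (\<Sum>i = 1..k. x i * real (card (f (v i)))) \<le> s"
    for x :: "nat \<Rightarrow> real" and s
    using packing_covering_weak_duality[of "{1..k}" x ?F "\<lambda>f i. real (card (f (v i)))" s p 1]
      that p v_in by simp

  show "is_maximum
       {ereal (\<Sum>i = 1..k. w i) | w :: nat \<Rightarrow> real.
          (\<forall>i\<in>{1..k}. 0 \<le> w i) \<and> (\<forall>f\<in>?F. (\<Sum>i = 1..k. w i * real (card (f (v i)))) \<le> 1)}
       (relative_fractional_independence_number G H)"
    unfolding is_maximum_def r(2)
  proof (intro conjI ballI CollectI exI)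
    show "ereal r = ereal (\<Sum>i = 1..k. w (v i))" by (simp only: reindex w(2))
    show "0 \<le> w (v i)" if "i \<in> {1..k}" for i using w(1) v_in that by blast
    show "(\<Sum>i = 1..k. w (v i) * real (card (f (v i)))) \<le> 1" if "f \<in> ?F" for f
      using w(3)[OF that] reindex[of "\<lambda>u. w u * real (card (f u))"] by simp
  qed (use weak[of _ 1] in auto)

  show "\<forall>w :: nat \<Rightarrow> real. (\<forall>i\<in>{1..k}. 0 \<le> w i) \<longrightarrow>
          ((\<forall>f\<in>?F. (\<Sum>i = 1..k. w i * real (card (f (v i)))) \<le> 1) \<longleftrightarrow>
           (\<forall>T :: nat \<Rightarrow> 'b set.
              (\<forall>i\<in>{1..k}. T i \<in> independent_sets H) \<and>
              (\<forall>i\<in>{1..k}. \<forall>j\<in>{1..k}.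
                 i \<noteq> j \<and> (v i, v j) \<notin> parcs G \<longrightarrow> disconnected H (T i) (T j)) \<longrightarrow>
              (\<Sum>i = 1..k. w i * real (card (T i))) \<le> 1))"
  proof (intro allI impI)
    fix w :: "nat \<Rightarrow> real"
    show "(\<forall>f\<in>?F. (\<Sum>i = 1..k. w i * real (card (f (v i)))) \<le> 1) \<longleftrightarrow>
           (\<forall>T :: nat \<Rightarrow> 'b set.
              (\<forall>i\<in>{1..k}. T i \<in> independent_sets H) \<and>
              (\<forall>i\<in>{1..k}. \<forall>j\<in>{1..k}.
                 i \<noteq> j \<and> (v i, v j) \<notin> parcs G \<longrightarrow> disconnected H (T i) (T j)) \<longrightarrow>
              (\<Sum>i = 1..k. w i * real (card (T i))) \<le> 1)"
      using independent_set_map_iff_family[OF v,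
          of H "\<lambda>T. (\<Sum>i = 1..k. w i * real (card (T i))) \<le> 1"] by simp
  qed

  show "is_minimum
         {ereal (Max ((\<lambda>f. \<Sum>i = 1..k. w i * real (card (f (v i)))) ` ?F))
          | w :: nat \<Rightarrow> real. (\<forall>i\<in>{1..k}. 0 \<le> w i) \<and> (\<Sum>i = 1..k. w i) = 1}
         (1 / relative_fractional_independence_number G H)"
  proof -
    define worst where "worst x = Max ((\<lambda>f. \<Sum>i = 1..k. x i * real (card (f (v i)))) ` ?F)"
      for x :: "nat \<Rightarrow> real"
    have lower: "1 / r \<le> worst x" if "\<forall>i\<in>{1..k}. 0 \<le> x i" "(\<Sum>i = 1..k. x i) = 1" for x
    proof -
      have "\<forall>f\<in>?F. (\<Sum>i = 1..k. x i * real (card (f (v i)))) \<le> worst x"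
        using finF by (auto simp: worst_def)
      from weak[OF that(1) this] that(2) r(1) show ?thesis by (simp add: pos_divide_le_eq)
    qed
    \<comment> \<open>The optimal weights of (i), scaled to total 1.\<close>
    let ?x = "\<lambda>i. w (v i) / r"
    have "0 \<le> ?x i" if "i \<in> {1..k}" for i
      using w(1)[OF v_in[OF that]] r(1) by simp
    moreover have "(\<Sum>i = 1..k. ?x i) = 1"
      unfolding sum_divide_distrib[symmetric] reindex w(2) using r(1) by simp
    moreover have "worst ?x \<le> 1 / r"
      unfolding worst_def
    proof (rule Max.boundedI)
      fix y assume "y \<in> (\<lambda>f. \<Sum>i = 1..k. ?x i * real (card (f (v i)))) ` ?F"
      then obtain f where f: "f \<in> ?F" "y = (\<Sum>i = 1..k. ?x i * real (card (f (v i))))" by blast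
      have "y = (\<Sum>u\<in>pverts G. w u * real (card (f u))) / r"
        using reindex[of "\<lambda>u. w u / r * real (card (f u))"] f(2)
        by (simp add: sum_divide_distrib)
      also have "\<dots> \<le> 1 / r" using w(3)[OF f(1)] r(1) by (intro divide_right_mono) auto
      finally show "y \<le> 1 / r" .
    qed (use finF independent_set_maps_nonempty in auto)
    ultimately have "worst ?x = 1 / r" "\<forall>i\<in>{1..k}. 0 \<le> ?x i" "(\<Sum>i = 1..k. ?x i) = 1"
      using lower[of ?x] by auto
    moreover have "1 / ereal r = ereal (1 / r)" using r(1) by (simp add: one_ereal_def)
    ultimately show ?thesis
      unfolding is_minimum_def r(2) worst_def[symmetric] using lower
      by (auto intro!: exI[of _ ?x])
  qed

  show "is_minimum
         {Max ((\<lambda>u. 1 / ereal (measure_pmf.expectation p (\<lambda>F. real (card (F u))))) ` pverts G)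
          | p :: ('a \<Rightarrow> 'b set) pmf. set_pmf p \<subseteq> ?F}
         (relative_fractional_independence_number G H)"
  proof -
    define E where "E q u = measure_pmf.expectation q (\<lambda>F. real (card (F u)))"
      for q :: "('a \<Rightarrow> 'b set) pmf" and u
    define worst where "worst q = Max ((\<lambda>u. 1 / ereal (E q u)) ` pverts G)" for q
    have E: "E q u = (\<Sum>f\<in>?F. pmf q f * real (card (f u)))" if "set_pmf q \<subseteq> ?F" for q u
      unfolding E_def using that
      by (subst integral_measure_pmf[OF finF]) auto
    have E_nonneg: "0 \<le> E q u" for q u by (simp add: E_def)
    \<comment> \<open>For \<open>e = 0\<close> the quotient is infinite in the extended reals, so
      both sides fail.\<close>
    have inverse_le: "1 / ereal e \<le> ereal r \<longleftrightarrow> 1 \<le> r * e" if "0 \<le> e" for e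
      using that r(1) by (cases "e = 0") (auto simp: one_ereal_def divide_le_eq)
    have lower: "ereal r \<le> worst q" if q: "set_pmf q \<subseteq> ?F" for q
    proof (rule ccontr)
      \<comment> \<open>Otherwise \<open>1 < r * E q u\<close> at every vertex. Summing with the
        weights \<open>w\<close> and exchanging the sums gives \<open>r < r\<close>, because each
        map has \<open>w\<close>-value at most 1.\<close>
      assume "\<not> ?thesis"
      then have less: "1 / ereal (E q u) < ereal r" if "u \<in> pverts G" for u
        using that finG by (auto simp: worst_def not_le dest!: Max_less_iff[THEN iffD1, rotated 2])
      have gt: "1 < r * E q u" if "u \<in> pverts G" for u
        using less[OF that] E_nonneg[of q u] r(1)
        by (cases "E q u = 0") (auto simp: one_ereal_def divide_less_eq)
      have le: "w u * 1 \<le> w u * (r * E q u)" if "u \<in> pverts G" for u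
        using gt[OF that] w(1)[OF that] by (intro mult_left_mono) auto
      \<comment> \<open>Strictness of the sum needs one vertex of positive weight; it exists since
        the total is \<open>r > 0\<close>.\<close>
      obtain u where u: "u \<in> pverts G" "0 < w u"
        using w(1,2) r(1) by (metis less_irrefl not_less order_antisym sum.neutral)
      have lt: "w u * 1 < w u * (r * E q u)"
        using gt[OF u(1)] u(2) by (intro mult_strict_left_mono) auto
      have "(\<Sum>u\<in>pverts G. w u * 1) < (\<Sum>u\<in>pverts G. w u * (r * E q u))"
        using finG le lt u(1) by (intro sum_strict_mono_ex1) blast+
      also have "\<dots> = r * (\<Sum>f\<in>?F. pmf q f * (\<Sum>u\<in>pverts G. w u * real (card (f u))))"
        unfolding E[OF q] sum_distrib_left by (subst sum.swap) (simp add: ac_simps)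
      also have "\<dots> \<le> r * (\<Sum>f\<in>?F. pmf q f * 1)"
        using w(3) r(1) by (intro mult_left_mono sum_mono) auto
      also have "\<dots> = r" using sum_pmf_eq_1[OF finF q] by simp
      finally show False using w(2) by simp
    qed
    \<comment> \<open>The dual solution has total \<open>r\<close>, so dividing by \<open>r\<close>
      gives a distribution, and \<open>r * E q u\<close> is the covering sum at
      \<open>u\<close>.\<close>
    obtain q where q: "set_pmf q \<subseteq> ?F" "\<And>f. f \<in> ?F \<Longrightarrow> pmf q f = p f / r"
      by (rule pmf_of_weights[of ?F "\<lambda>f. p f / r"])
        (use finF p(1,2) r(1) in \<open>auto simp: sum_divide_distrib[symmetric]\<close>)
    have "1 / ereal (E q u) \<le> ereal r" if "u \<in> pverts G" for u
    proof -
      have "r * E q u = (\<Sum>f\<in>?F. p f * real (card (f u)))"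
        using r(1) by (simp add: E[OF q(1)] q(2) sum_distrib_left)
      then show ?thesis using inverse_le[OF E_nonneg] p(3)[OF that] by simp
    qed
    then have "worst q \<le> ereal r"
      unfolding worst_def using finG G by (intro Max.boundedI) (auto simp: nonempty_graph_def)
    then have "worst q = ereal r" using lower[OF q(1)] by simp
    then show ?thesis
      unfolding is_minimum_def r(2) E_def[symmetric] worst_def[symmetric] using lower q(1)
      by (auto intro!: exI[of _ q])
  qed

  show "\<exists>W :: nat pair_pre_digraph. nonempty_graph W \<and>
          relative_fractional_independence_number G H = ereal (independence_ratio G H W)"
    using W r(2) by auto
qed

end
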